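(* Let $N\ge3$. For every $a\in\mathcal P_N$ and $\sigma\in\mathbb R$, $$\mathcal T_\sigma(a)=\sup_{J\in\mathbb R}\left\{J\sigma+\sum_{j=0}^{N-1}g_J(a_ja_{j+1})\right\},$$ where, for $w>0$ and $J\in\mathbb R$, $$g_J(w):=\sqrt{w^2+J^2}-J\operatorname{arsinh}\left(\frac Jw\right).$$
   Context: Indices are modulo $N$. $\mathcal P_N=\{a\in(0,\infty)^N:\sum_ja_j^2=1\}$, and for $\sigma\in\mathbb R$, $$\mathcal T_\sigma(a):=\min_{\substack{\theta\in\mathbb R^N\\ \sum_j\theta_j=\sigma}}\ \sum_{j=0}^{N-1}a_ja_{j+1}\cosh\theta_j .$$ $\operatorname{arsinh}$ is the inverse of $\sinh$ on $\mathbb R$. *)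

theory Defs
  imports Complex_Main "HOL-Library.Extended_Real"
begin

text \<open>
  Vectors in \<open>\<real>\<^sup>N\<close> are functions \<^typ>\<open>nat \<Rightarrow> real\<close> of which only the values at
  \<open>0, \<dots>, N - 1\<close> are used; cyclic indices are reduced by \<open>mod N\<close>.
\<close>

definition positive_sphere :: "nat \<Rightarrow> (nat \<Rightarrow> real) set" where
  "positive_sphere N = {a. (\<forall>j<N. a j > 0) \<and> (\<Sum>j<N. (a j)\<^sup>2) = 1}"

definition cyclic_weight :: "nat \<Rightarrow> (nat \<Rightarrow> real) \<Rightarrow> nat \<Rightarrow> real" where
  "cyclic_weight N a j = a j * a ((j + 1) mod N)"

definition twist_values :: "nat \<Rightarrow> real \<Rightarrow> (nat \<Rightarrow> real) \<Rightarrow> real set" where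
  "twist_values N \<sigma> a =
     {(\<Sum>j<N. cyclic_weight N a j * cosh (\<theta> j)) | \<theta> :: nat \<Rightarrow> real. (\<Sum>j<N. \<theta> j) = \<sigma>}"

text \<open>
  The minimum is the least element of the set of values, which is specified only if
  the minimum is attained; it is not merely an infimum.
\<close>

definition twist_min :: "nat \<Rightarrow> real \<Rightarrow> (nat \<Rightarrow> real) \<Rightarrow> real" where
  "twist_min N \<sigma> a = (LEAST t. t \<in> twist_values N \<sigma> a)"

definition g :: "real \<Rightarrow> real \<Rightarrow> real" where
  "g J w = sqrt (w\<^sup>2 + J\<^sup>2) - J * arsinh (J / w)"

end

theory Submission imports Defs begin

text \<open>
  By convexity of \<open>cosh\<close>, \<open>w cosh t - J t\<close> is minimal where \<open>sinh t = J / w\<close>, with minimal value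
  \<open>g J w\<close>; summing gives weak duality for every \<open>J\<close>. By the intermediate value theorem some \<open>J\<close>
  makes the minimisers \<open>arsinh (J / w\<^sub>j)\<close> satisfy the constraint on the sum of the angles; for
  this \<open>J\<close> both sides take the same value.
\<close>

text \<open>Half the sum of two instances of \<open>1 + x \<le> exp x\<close>, at
  \<open>x = t - s\<close> and \<open>x = s - t\<close>, weighted by \<open>exp s\<close> and
  \<open>exp (- s)\<close>.\<close>

lemma cosh_tangent_le:
  fixes s t :: real
  shows "cosh s + sinh s * (t - s) \<le> cosh t"
proof -
  have "exp s * (1 + (t - s)) \<le> exp s * exp (t - s)"
    by (intro mult_left_mono exp_ge_add_one_self) simp
  moreover have "exp (- s) * (1 + (s - t)) \<le> exp (- s) * exp (s - t)"
    by (intro mult_left_mono exp_ge_add_one_self) simp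
  ultimately show ?thesis
    by (simp add: cosh_def sinh_def field_simps flip: exp_add)
qed

lemma g_eq:
  assumes "w > 0"
  shows "g J w = w * cosh (arsinh (J / w)) - J * arsinh (J / w)"
proof -
  have "w * cosh (arsinh (J / w)) = w * sqrt ((J / w)\<^sup>2 + 1)"
    by (simp add: cosh_arsinh_real)
  also have "\<dots> = sqrt (w\<^sup>2 * ((J / w)\<^sup>2 + 1))"
    using assms by (simp add: real_sqrt_mult)
  also have "w\<^sup>2 * ((J / w)\<^sup>2 + 1) = w\<^sup>2 + J\<^sup>2"
    using assms by (simp add: field_simps)
  finally show ?thesis
    by (simp add: g_def)
qed

text \<open>The tangent to \<open>w * cosh\<close> at \<open>arsinh (J / w)\<close> has slope
  \<open>J\<close> and, by \<open>g_eq\<close>, intercept \<open>g J w\<close>.\<close>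

lemma g_le:
  assumes "w > 0"
  shows "J * t + g J w \<le> w * cosh t"
proof -
  have "w * (cosh (arsinh (J / w)) + sinh (arsinh (J / w)) * (t - arsinh (J / w))) \<le> w * cosh t"
    using assms by (intro mult_left_mono cosh_tangent_le) simp
  then show ?thesis
    using assms by (simp add: g_eq algebra_simps)
qed

lemma sum_arsinh_surj:
  fixes w :: "'a \<Rightarrow> real" and \<sigma> :: real
  assumes "finite I" "I \<noteq> {}" and pos: "\<And>i. i \<in> I \<Longrightarrow> w i > 0"
  obtains J where "(\<Sum>i\<in>I. arsinh (J / w i)) = \<sigma>"
proof -
  define F where "F J = (\<Sum>i\<in>I. arsinh (J / w i))" for J
  obtain k where k: "k \<in> I"
    using \<open>I \<noteq> {}\<close> by blast
  \<comment> \<open>With this choice the summand at \<open>k\<close> alone equals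
    \<open>\<bar>\<sigma>\<bar>\<close>, and the other summands of \<open>F K\<close> are
    nonnegative.\<close>
  define K where "K = w k * sinh \<bar>\<sigma>\<bar>"
  have "K \<ge> 0"
    using pos[OF k] by (simp add: K_def)
  have nonneg: "0 \<le> arsinh (K / w i)" if "i \<in> I" for i
    using pos[OF that] \<open>K \<ge> 0\<close> sinh_real_nonneg_iff[of "arsinh (K / w i)"]
    by (simp add: sinh_arsinh_real)
  have "\<bar>\<sigma>\<bar> = arsinh (K / w k)"
    using pos[OF k] by (simp add: K_def arsinh_sinh_real del: sinh_real_abs)
  also have "\<dots> \<le> F K"
    unfolding F_def using nonneg k \<open>finite I\<close>
    by (intro member_le_sum) auto
  finally have upper: "\<bar>\<sigma>\<bar> \<le> F K" .
  \<comment> \<open>Oddness turns the bound at \<open>K\<close> into one at \<open>- K\<close>, so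
    that \<sigma> lies between \<open>F (- K)\<close> and \<open>F K\<close>.\<close>
  have "F (- K) = - F K"
    by (simp add: F_def arsinh_minus_real sum_negf)
  moreover have "continuous_on {- K..K} F"
    unfolding F_def using pos by (intro continuous_intros) force
  ultimately obtain J where "F J = \<sigma>"
    using IVT'[of F "- K" \<sigma> K] upper \<open>K \<ge> 0\<close> by force
  then show thesis
    using that by (simp add: F_def)
qed

theorem lemma2p4:
  fixes N :: nat and a :: "nat \<Rightarrow> real" and \<sigma> :: real
  assumes "N \<ge> 3" and "a \<in> positive_sphere N"
  shows "ereal (twist_min N \<sigma> a) =
    (SUP J::real. ereal (J * \<sigma> + (\<Sum>j<N. g J (cyclic_weight N a j))))"
proof -
  define w where "w = cyclic_weight N a"
  have pos: "w j > 0" if "j < N" for j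
    using assms that by (simp add: w_def cyclic_weight_def positive_sphere_def)
  define D where "D J = J * \<sigma> + (\<Sum>j<N. g J (w j))" for J
  have weak: "D J \<le> t" if "t \<in> twist_values N \<sigma> a" for J t
  proof -
    obtain \<theta> where \<theta>: "t = (\<Sum>j<N. w j * cosh (\<theta> j))" "(\<Sum>j<N. \<theta> j) = \<sigma>"
      using \<open>t \<in> twist_values N \<sigma> a\<close> by (auto simp: twist_values_def w_def)
    have "D J = (\<Sum>j<N. J * \<theta> j + g J (w j))"
      by (simp add: D_def sum.distrib sum_distrib_left flip: \<theta>(2))
    also have "\<dots> \<le> t"
      unfolding \<theta>(1) by (intro sum_mono g_le) (simp add: pos)
    finally show ?thesis .
  qed
  have "{..<N} \<noteq> {}"
    using \<open>N \<ge> 3\<close> by (simp add: lessThan_empty_iff)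
  then obtain J where J: "(\<Sum>j<N. arsinh (J / w j)) = \<sigma>"
    using sum_arsinh_surj[of "{..<N}" w \<sigma>] pos by auto
  have "D J = (\<Sum>j<N. J * arsinh (J / w j) + g J (w j))"
    by (simp add: D_def sum.distrib sum_distrib_left flip: J)
  \<comment> \<open>By \<open>g_eq\<close> the terms linear in \<open>J\<close> cancel in each
    summand.\<close>
  also have "\<dots> = (\<Sum>j<N. w j * cosh (arsinh (J / w j)))"
    by (intro sum.cong) (simp_all add: g_eq pos)
  finally have attained: "D J \<in> twist_values N \<sigma> a"
    unfolding twist_values_def w_def[symmetric]
    using J by (auto intro!: exI[of _ "\<lambda>j. arsinh (J / w j)"])
  have "twist_min N \<sigma> a = D J"
    unfolding twist_min_def by (intro Least_equality attained weak)
  \<comment> \<open>Since \<open>D J\<close> is itself a twist value, weak duality bounds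
    \<open>D\<close> at every other parameter by it: the supremum is attained at this
    \<open>J\<close>.\<close>
  moreover have "(SUP J. ereal (D J)) = ereal (D J)"
    by (intro SUP_eqI) (auto intro: weak attained)
  ultimately show ?thesis
    by (simp add: D_def w_def)
qed

end
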